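(* For all integers $n\geq m\geq 1$, $$\beta(K_n\,\square\,K_m)=\begin{cases}\left\lfloor \tfrac23(n+m-1)\right\rfloor, & \text{if } m\leq n\leq 2m-1,\\ n-1, & \text{if } n\geq 2m-1.\end{cases}$$
   Context: $K_n$ is the complete graph on $n$ vertices. $d(v,w)$ denotes shortest-path distance. A vertex $x$ resolves $v,w$ if $d(v,x)\neq d(w,x)$; a set resolves a graph if every pair of distinct vertices is resolved by some vertex of the set; $\beta(G)$ is the minimum size of a resolving set. The cartesian product $G\,\square\,H$ has vertex set $V(G)\times V(H)$, with $(a,v)\sim(b,w)$ iff ($a=b$ and $vw\in E(H)$) or ($v=w$ and $ab\in E(G)$). *)

theory Defs
  imports "Graph_Theory.Graph_Theory"
begin

text \<open>
  Finite simple undirected graphs are symmetric loop-free digraphs without parallel arcs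
  (locales \<^locale>\<open>graph\<close> and \<^locale>\<open>pair_graph\<close>); an edge is the pair of its two orientations.
\<close>

text \<open>
  With every arc of cost 1, the cost of a walk is its length, so the infimum over all walks
  is the shortest-path distance (infinite between different components).
\<close>
definition gdist :: "('a, 'b) pre_digraph \<Rightarrow> 'a \<Rightarrow> 'a \<Rightarrow> ereal" where
  "gdist G v w = wf_digraph.\<mu> G (\<lambda>_. 1) v w"

definition resolves :: "('a, 'b) pre_digraph \<Rightarrow> 'a \<Rightarrow> 'a \<Rightarrow> 'a \<Rightarrow> bool" where
  "resolves G x v w \<longleftrightarrow> gdist G v x \<noteq> gdist G w x"

definition resolving_set :: "('a, 'b) pre_digraph \<Rightarrow> 'a set \<Rightarrow> bool" where
  "resolving_set G S \<longleftrightarrow> S \<subseteq> verts G \<and>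
     (\<forall>v\<in>verts G. \<forall>w\<in>verts G. v \<noteq> w \<longrightarrow> (\<exists>x\<in>S. resolves G x v w))"

text \<open>
  Meaningful for finite graphs: the set of all vertices is then a finite resolving set,
  so the minimum is attained.
\<close>
definition metric_dim :: "('a, 'b) pre_digraph \<Rightarrow> nat" (\<open>\<beta>\<close>) where
  "\<beta> G = (LEAST k. \<exists>S. resolving_set G S \<and> finite S \<and> card S = k)"

definition cartesian_product ::
    "'a pair_pre_digraph \<Rightarrow> 'b pair_pre_digraph \<Rightarrow> ('a \<times> 'b) pair_pre_digraph" (infixl \<open>\<box>\<close> 70)
  where
  "G \<box> H = \<lparr> pverts = pverts G \<times> pverts H,
     parcs = {((a, v), (b, w)) | a v b w.
       (a, v) \<in> pverts G \<times> pverts H \<and> (b, w) \<in> pverts G \<times> pverts H \<and>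
       (a = b \<and> (v, w) \<in> parcs H \<or> v = w \<and> (a, b) \<in> parcs G)} \<rparr>"

lemma pair_graph_cartesian_product:
  assumes "pair_graph G" "pair_graph H"
  shows "pair_graph (G \<box> H)"
proof -
  interpret G: pair_graph G by fact
  interpret H: pair_graph H by fact
  have "parcs (G \<box> H) \<subseteq> (pverts G \<times> pverts H) \<times> (pverts G \<times> pverts H)"
    by (auto simp: cartesian_product_def)
  then have "finite (parcs (G \<box> H))"
    by (rule finite_subset) simp
  moreover have "sym (parcs G)" "sym (parcs H)"
    using G.pair_sym_arcs H.pair_sym_arcs by (simp_all add: symmetric_def)
  ultimately show ?thesis
    by unfold_locales
      (auto simp: cartesian_product_def symmetric_def
        dest: symD G.pair_no_loops H.pair_no_loops intro!: symI)
qed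

lemma resolving_set_verts:
  assumes "graph G"
  shows "resolving_set G (verts G)"
proof -
  interpret graph G by fact
  have self: "gdist G v v = 0" if "v \<in> verts G" for v
  proof (rule antisym)
    show "gdist G v v \<le> 0"
      using that min_cost_le_walk_cost[of v "[]" v "\<lambda>_. 1"]
      by (simp add: gdist_def awalk_Nil_iff zero_ereal_def)
    show "0 \<le> gdist G v v"
      unfolding gdist_def \<mu>_def by (rule INF_greatest) (auto intro: pos_cost_pos_awalk_cost)
  qed
  have other: "1 \<le> gdist G v w" if "v \<noteq> w" for v w
    unfolding gdist_def \<mu>_def
  proof (rule INF_greatest)
    fix p assume "p \<in> {p. awalk v p w}"
    with that have "p \<noteq> []" by (auto simp: awalk_Nil_iff)
    then show "1 \<le> ereal (awalk_cost (\<lambda>_. 1) p)"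
      by (cases p) (auto simp: awalk_cost_def sum_list_triv one_ereal_def)
  qed
  show ?thesis
    unfolding resolving_set_def resolves_def
  proof (intro conjI ballI impI subset_refl)
    fix v w assume "v \<in> verts G" "w \<in> verts G" "v \<noteq> w"
    with self[of w] other[of v w] have "gdist G v w \<noteq> gdist G w w" by auto
    with \<open>w \<in> verts G\<close> show "\<exists>x\<in>verts G. gdist G v x \<noteq> gdist G w x" by blast
  qed
qed

end

theory Submission
  imports Defs
begin

text \<open>
  View a set \<open>S\<close> of vertices of the product as the edge set of a bipartite graph between rows and
  columns. Then \<open>S\<close> is resolving iff at most one row and at most one column are isolated, and the
  graph has at most one component that is a single edge, and none if both an isolated row and an
  isolated column exist. All remaining components have at least two edges for every three
  vertices, with equality for the paths on three vertices. Allowing for the exceptional components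
  this gives \<open>3 * card S + 4 \<ge> 2 * (n + m)\<close>, besides \<open>card S \<ge> n - 1\<close>. For \<open>n \<le> 2 * m - 1\<close> one
  packs paths on three vertices; for larger \<open>n\<close> one uses stars centred at the columns.
\<close>

section \<open>Distances in a product of complete graphs\<close>

definition rook_dist :: "'a \<times> 'b \<Rightarrow> 'a \<times> 'b \<Rightarrow> nat" where
  "rook_dist p q = of_bool (fst p \<noteq> fst q) + of_bool (snd p \<noteq> snd q)"

text \<open>Graph-free form on arbitrary carriers, so that rows and columns can later be renamed to
  initial segments of the naturals.\<close>

definition grid_resolving :: "'a set \<Rightarrow> 'b set \<Rightarrow> ('a \<times> 'b) set \<Rightarrow> bool" where
  "grid_resolving A B S \<longleftrightarrow> S \<subseteq> A \<times> B \<and>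
     (\<forall>p\<in>A \<times> B. \<forall>q\<in>A \<times> B. p \<noteq> q \<longrightarrow> (\<exists>x\<in>S. rook_dist p x \<noteq> rook_dist q x))"

text \<open>
  Row \<open>a\<close> and column \<open>v\<close> form an isolated edge of \<open>S\<close>, or are both isolated vertices: these are the
  two ways in which such a pair can take part in an unresolved pair of vertices.
\<close>
definition lonely :: "('a \<times> 'b) set \<Rightarrow> 'a \<Rightarrow> 'b \<Rightarrow> bool" where
  "lonely S a v \<longleftrightarrow> (\<forall>x\<in>S. fst x = a \<longleftrightarrow> snd x = v)"

text \<open>Every arc changes exactly one coordinate, so the triangle inequality for
  \<open>rook_dist\<close> bounds walk lengths from below; a walk turning at the corner
  \<open>(fst p, snd q)\<close> attains the value 2.\<close>

lemma gdist_complete_product: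
  assumes G: "complete_digraph n (with_proj G)" and H: "complete_digraph m (with_proj H)"
    and p: "p \<in> pverts G \<times> pverts H" and q: "q \<in> pverts G \<times> pverts H"
  shows "gdist (with_proj (G \<box> H)) p q = ereal (rook_dist p q)"
proof -
  have arcs: "parcs G = {(u, v). (u, v) \<in> pverts G \<times> pverts G \<and> u \<noteq> v}"
    "parcs H = {(u, v). (u, v) \<in> pverts H \<times> pverts H \<and> u \<noteq> v}"
    using G H by (simp_all add: complete_digraph_pair_def)
  interpret pair_graph "G \<box> H"
    using pair_graph_cartesian_product[OF pair_graphI_complete[OF G] pair_graphI_complete[OF H]] .
  have V: "pverts (G \<box> H) = pverts G \<times> pverts H"
    by (simp add: cartesian_product_def)
  have E: "(x, y) \<in> parcs (G \<box> H) \<longleftrightarrow> x \<in> pverts G \<times> pverts H \<and> y \<in> pverts G \<times> pverts H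
      \<and> rook_dist x y = 1" for x y
    by (cases x; cases y) (auto simp: cartesian_product_def arcs rook_dist_def)
  have lower: "real (rook_dist x y) \<le> awalk_cost (\<lambda>_. 1) es" if "awalk x es y" for x es y
    using that
  proof (induction es arbitrary: x)
    case Nil
    then show ?case by (simp add: awalk_Nil_iff rook_dist_def)
  next
    case (Cons e es)
    obtain z where e: "e = (x, z)" and E': "(x, z) \<in> parcs (G \<box> H)" and w: "awalk z es y"
      using Cons.prems by (cases e) (auto simp: awalk_Cons_iff)
    have "rook_dist x y \<le> rook_dist x z + rook_dist z y"
      by (auto simp: rook_dist_def)
    then have "rook_dist x y \<le> 1 + rook_dist z y"
      using E' E by simp
    with Cons.IH[OF w] show ?case by simp
  qed
  have "\<exists>es. awalk p es q \<and> awalk_cost (\<lambda>_. 1) es = rook_dist p q"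
  proof -
    consider "p = q" | "rook_dist p q = 1" | "rook_dist p q = 2"
      by (cases "fst p = fst q"; cases "snd p = snd q") (auto simp: rook_dist_def prod_eq_iff)
    then show ?thesis
    proof cases
      case 1
      then have "awalk p [] q" using p V by (simp add: awalk_Nil_iff)
      with 1 show ?thesis by (intro exI[of _ "[]"]) (simp add: rook_dist_def)
    next
      case 2
      then have "awalk p [(p, q)] q" using p q V E by (simp add: awalk_Cons_iff awalk_Nil_iff)
      with 2 show ?thesis by (intro exI[of _ "[(p, q)]"]) simp
    next
      case 3
      let ?z = "(fst p, snd q)"
      have z: "?z \<in> pverts G \<times> pverts H" using p q by auto
      have "fst p \<noteq> fst q" "snd p \<noteq> snd q" using 3 by (auto simp: rook_dist_def of_bool_def split: if_splits)
      then have "rook_dist p ?z = 1" "rook_dist ?z q = 1" by (auto simp: rook_dist_def)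
      then have "awalk p [(p, ?z), (?z, q)] q"
        using p q z V E by (simp add: awalk_Cons_iff awalk_Nil_iff)
      with 3 show ?thesis by (intro exI[of _ "[(p, ?z), (?z, q)]"]) simp
    qed
  qed
  then obtain es where es: "awalk p es q" "awalk_cost (\<lambda>_. 1) es = rook_dist p q" by blast
  show ?thesis
  proof (rule antisym)
    show "gdist (with_proj (G \<box> H)) p q \<le> ereal (rook_dist p q)"
      using min_cost_le_walk_cost[OF es(1), of "\<lambda>_. 1"] es(2) by (simp add: gdist_def)
    show "ereal (rook_dist p q) \<le> gdist (with_proj (G \<box> H)) p q"
      unfolding gdist_def \<mu>_def by (rule INF_greatest) (use lower in auto)
  qed
qed

lemma resolving_set_complete_product:
  assumes G: "complete_digraph n (with_proj G)" and H: "complete_digraph m (with_proj H)"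
  shows "resolving_set (with_proj (G \<box> H)) S \<longleftrightarrow> grid_resolving (pverts G) (pverts H) S"
proof -
  have V: "verts (with_proj (G \<box> H)) = pverts G \<times> pverts H"
    by (simp add: cartesian_product_def)
  show ?thesis
    unfolding resolving_set_def grid_resolving_def resolves_def V
    using gdist_complete_product[OF G H] by (smt (verit) ereal.inject of_nat_eq_iff subsetD)
qed

section \<open>Resolving sets as bipartite graphs\<close>

text \<open>Two vertices in one column are told apart exactly by elements of \<open>S\<close> in one
  of their rows, and symmetrically for one row. If both coordinates differ, the vertices are
  opposite corners \<open>(a, w)\<close> and \<open>(b, v)\<close> of a rectangle, and they are
  unresolved iff the other two corners are both \<open>lonely\<close>.\<close>

lemma grid_resolving_iff:
  assumes "A \<noteq> {}" "B \<noteq> {}"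
  shows "grid_resolving A B S \<longleftrightarrow> S \<subseteq> A \<times> B \<and>
     (\<forall>a\<in>A - fst ` S. \<forall>b\<in>A - fst ` S. a = b) \<and> (\<forall>v\<in>B - snd ` S. \<forall>w\<in>B - snd ` S. v = w) \<and>
     (\<forall>a\<in>A. \<forall>b\<in>A. \<forall>v\<in>B. \<forall>w\<in>B. lonely S a v \<longrightarrow> lonely S b w \<longrightarrow> a = b \<or> v = w)"
  (is "_ \<longleftrightarrow> ?sub \<and> ?rows \<and> ?cols \<and> ?lone")
proof
  assume R: "grid_resolving A B S"
  then have sub: ?sub by (simp add: grid_resolving_def)
  have D: "\<exists>x\<in>S. rook_dist (a, v) x \<noteq> rook_dist (b, w) x"
    if "a \<in> A" "b \<in> A" "v \<in> B" "w \<in> B" "a \<noteq> b \<or> v \<noteq> w" for a b v w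
    using R that unfolding grid_resolving_def by blast
  have ?rows
  proof (intro ballI, rule ccontr)
    fix a b assume ab: "a \<in> A - fst ` S" "b \<in> A - fst ` S" "a \<noteq> b"
    obtain v where "v \<in> B" using assms by blast
    with ab obtain x where "x \<in> S" "rook_dist (a, v) x \<noteq> rook_dist (b, v) x"
      using D[of a b v v] by blast
    moreover have "fst x \<noteq> a" "fst x \<noteq> b" using ab \<open>x \<in> S\<close> by auto
    ultimately show False by (simp add: rook_dist_def)
  qed
  moreover have ?cols
  proof (intro ballI, rule ccontr)
    fix v w assume vw: "v \<in> B - snd ` S" "w \<in> B - snd ` S" "v \<noteq> w"
    obtain a where "a \<in> A" using assms by blast
    with vw obtain x where "x \<in> S" "rook_dist (a, v) x \<noteq> rook_dist (a, w) x"
      using D[of a a v w] by blast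
    moreover have "snd x \<noteq> v" "snd x \<noteq> w" using vw \<open>x \<in> S\<close> by auto
    ultimately show False by (simp add: rook_dist_def)
  qed
  moreover have ?lone
  proof (intro ballI impI, rule ccontr)
    fix a b v w
    assume *: "a \<in> A" "b \<in> A" "v \<in> B" "w \<in> B" "lonely S a v" "lonely S b w" "\<not> (a = b \<or> v = w)"
    then obtain x where x: "x \<in> S" "rook_dist (a, w) x \<noteq> rook_dist (b, v) x"
      using D[of a b w v] by blast
    from * x(1) have "fst x = a \<longleftrightarrow> snd x = v" "fst x = b \<longleftrightarrow> snd x = w"
      by (auto simp: lonely_def)
    with * x(2) show False by (auto simp: rook_dist_def of_bool_def split: if_splits)
  qed
  ultimately show "?sub \<and> ?rows \<and> ?cols \<and> ?lone" using sub by blast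
next
  assume *: "?sub \<and> ?rows \<and> ?cols \<and> ?lone"
  have "\<exists>x\<in>S. rook_dist (a, w) x \<noteq> rook_dist (b, v) x"
    if ab: "a \<in> A" "b \<in> A" "v \<in> B" "w \<in> B" "(a, w) \<noteq> (b, v)" for a b v w
  proof -
    consider "a = b" "v \<noteq> w" | "a \<noteq> b" "v = w" | "a \<noteq> b" "v \<noteq> w" using ab by blast
    then show ?thesis
    proof cases
      case 1
      with * ab have "v \<in> snd ` S \<or> w \<in> snd ` S" by blast
      with 1 show ?thesis by (force simp: rook_dist_def)
    next
      case 2
      with * ab have "a \<in> fst ` S \<or> b \<in> fst ` S" by blast
      with 2 show ?thesis by (force simp: rook_dist_def)
    next
      case 3
      with * ab have "\<not> lonely S a v \<or> \<not> lonely S b w" by blast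
      then obtain x where "x \<in> S" "(fst x = a) \<noteq> (snd x = v) \<or> (fst x = b) \<noteq> (snd x = w)"
        by (auto simp: lonely_def)
      with 3 show ?thesis by (intro bexI[of _ x]) (auto simp: rook_dist_def)
    qed
  qed
  then have "\<exists>x\<in>S. rook_dist p x \<noteq> rook_dist q x"
    if "p \<in> A \<times> B" "q \<in> A \<times> B" "p \<noteq> q" for p q
    using that by (cases p; cases q) simp
  with * show "grid_resolving A B S" unfolding grid_resolving_def by simp
qed

lemma grid_resolving_transfer:
  assumes S: "grid_resolving A B S" and f: "bij_betw f A A'" and g: "bij_betw g B B'"
  shows "grid_resolving A' B' (map_prod f g ` S)" "card (map_prod f g ` S) = card S"
proof -
  have sub: "S \<subseteq> A \<times> B" using S by (simp add: grid_resolving_def)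
  have fg: "bij_betw (map_prod f g) (A \<times> B) (A' \<times> B')"
    using bij_betw_map_prod[OF f g] .
  have dist: "rook_dist (map_prod f g p) (map_prod f g q) = rook_dist p q"
    if "p \<in> A \<times> B" "q \<in> A \<times> B" for p q
    using that f g by (cases p; cases q) (auto simp: rook_dist_def bij_betw_def inj_on_eq_iff)
  show "card (map_prod f g ` S) = card S"
    using inj_on_subset[OF bij_betw_imp_inj_on[OF fg] sub] by (rule card_image)
  show "grid_resolving A' B' (map_prod f g ` S)"
    unfolding grid_resolving_def
  proof (intro conjI ballI impI)
    show "map_prod f g ` S \<subseteq> A' \<times> B'" using sub fg by (auto simp: bij_betw_def)
    fix p' q' assume "p' \<in> A' \<times> B'" "q' \<in> A' \<times> B'" and neq: "p' \<noteq> q'"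
    then have im: "p' \<in> map_prod f g ` (A \<times> B)" "q' \<in> map_prod f g ` (A \<times> B)"
      by (simp_all only: bij_betw_imp_surj_on[OF fg])
    obtain p where p: "p' = map_prod f g p" "p \<in> A \<times> B" using im(1) by (rule imageE)
    obtain q where q: "q' = map_prod f g q" "q \<in> A \<times> B" using im(2) by (rule imageE)
    have "p \<noteq> q" using p(1) q(1) neq by blast
    then obtain x where x: "x \<in> S" "rook_dist p x \<noteq> rook_dist q x"
      using S p(2) q(2) unfolding grid_resolving_def by blast
    then have "x \<in> A \<times> B" using sub by blast
    with x p q dist have "rook_dist p' (map_prod f g x) \<noteq> rook_dist q' (map_prod f g x)" by simp
    with x(1) show "\<exists>x\<in>map_prod f g ` S. rook_dist p' x \<noteq> rook_dist q' x" by blast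
  qed
qed

section \<open>Lower bounds by counting reciprocal degrees\<close>

text \<open>Each nonempty fibre of size \<open>k\<close> contributes \<open>k\<close> terms
  \<open>1 / k\<close>, hence 1. For \<open>h\<close> a projection the fibre sizes are the degrees
  of rows or columns.\<close>

lemma sum_inverse_card_fibre:
  assumes "finite S"
  shows "(\<Sum>x\<in>S. 1 / real (card {y\<in>S. h y = h x})) = real (card (h ` S))"
proof -
  have "(\<Sum>x\<in>S. 1 / real (card {y\<in>S. h y = h x}))
      = (\<Sum>z\<in>h ` S. \<Sum>x\<in>{x\<in>S. h x = z}. 1 / real (card {y\<in>S. h y = h x}))"
    using assms by (rule sum.image_gen)
  also have "\<dots> = (\<Sum>z\<in>h ` S. 1)"
  proof (rule sum.cong)
    fix z assume "z \<in> h ` S"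
    then have "card {y\<in>S. h y = z} \<noteq> 0" using assms by auto
    then show "(\<Sum>x\<in>{x\<in>S. h x = z}. 1 / real (card {y\<in>S. h y = h x})) = 1" by simp
  qed simp
  finally show ?thesis by simp
qed

text \<open>
  Each edge distributes the reciprocals of the degrees of its two ends; these add up to at most
  \<open>3 / 2\<close> unless the edge is isolated.
\<close>
lemma card_projections_le:
  assumes fin: "finite S"
  shows "2 * (card (fst ` S) + card (snd ` S)) \<le> 3 * card S + card {x\<in>S. lonely S (fst x) (snd x)}"
    (is "_ \<le> _ + card ?J")
proof -
  let ?r = "\<lambda>x. card {y\<in>S. fst y = fst x}" and ?c = "\<lambda>x. card {y\<in>S. snd y = snd x}"
  have term_le: "1 / real (?r x) + 1 / real (?c x) \<le> 3 / 2 + of_bool (x \<in> ?J) / 2" if x: "x \<in> S" for x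
  proof -
    have "{y\<in>S. fst y = fst x} \<noteq> {}" "{y\<in>S. snd y = snd x} \<noteq> {}" using x by blast+
    then have pos: "?r x \<ge> 1" "?c x \<ge> 1" using fin by (simp_all add: Suc_le_eq card_gt_0_iff)
    then have le1: "1 / real (?r x) \<le> 1" "1 / real (?c x) \<le> 1" by simp_all
    have half: "1 / real k \<le> 1 / 2" if "k \<ge> 2" for k :: nat
      using that by (simp add: field_simps)
    show ?thesis
    proof (cases "?r x \<ge> 2 \<or> ?c x \<ge> 2")
      case True
      have "1 / real (?r x) + 1 / real (?c x) \<le> 3 / 2"
        using True half[of "?r x"] half[of "?c x"] le1 by linarith
      also have "\<dots> \<le> 3 / 2 + of_bool (x \<in> ?J) / 2" by simp
      finally show ?thesis .
    next
      case False
      then have "card {y\<in>S. fst y = fst x} \<le> Suc 0" "card {y\<in>S. snd y = snd x} \<le> Suc 0"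
        by linarith+
      then have "\<forall>y\<in>{y\<in>S. fst y = fst x}. \<forall>z\<in>{y\<in>S. fst y = fst x}. y = z"
        "\<forall>y\<in>{y\<in>S. snd y = snd x}. \<forall>z\<in>{y\<in>S. snd y = snd x}. y = z"
        using fin by (simp_all add: card_le_Suc0_iff_eq)
      then have "y = x" if "y \<in> S" "fst y = fst x \<or> snd y = snd x" for y
        using x that by (cases x; cases y) auto
      then have "x \<in> ?J" using x by (auto simp: lonely_def)
      with le1 show ?thesis by simp
    qed
  qed
  have "real (card (fst ` S)) + real (card (snd ` S)) = (\<Sum>x\<in>S. 1 / real (?r x) + 1 / real (?c x))"
    by (simp add: sum.distrib sum_inverse_card_fibre fin)
  also have "\<dots> \<le> (\<Sum>x\<in>S. 3 / 2 + of_bool (x \<in> ?J) / 2)"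
    using term_le by (rule sum_mono)
  also have "\<dots> = 3 / 2 * real (card S) + real (card ?J) / 2"
    using fin by (simp add: sum.distrib sum_divide_distrib[symmetric] sum_of_bool_eq Int_def)
  finally show ?thesis unfolding distrib_left by linarith
qed

lemma card_le_Suc_0_Diff:
  assumes "finite A" "T \<subseteq> A" "\<forall>a\<in>A - T. \<forall>b\<in>A - T. a = b"
  shows "card A \<le> Suc (card T)" "card A = Suc (card T) \<Longrightarrow> A - T \<noteq> {}"
proof -
  have "card (A - T) \<le> Suc 0" using assms by (intro card_le_Suc0_iff_eq[THEN iffD2]) auto
  then show "card A \<le> Suc (card T)"
    using assms by (simp add: card_Diff_subset finite_subset)
  show "card A = Suc (card T) \<Longrightarrow> A - T \<noteq> {}"
    using assms by (metis Diff_eq_empty_iff n_not_Suc_n subset_antisym)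
qed

text \<open>The projections of \<open>S\<close> miss at most one row and one column. If both are
  missed, no isolated edge remains and the missing vertices cost 4 in the doubled count. Otherwise
  at most one vertex is missing, costing 2, and the at most one isolated edge costs 1 more.\<close>

lemma grid_resolving_card_ge:
  assumes R: "grid_resolving A B S" and fin: "finite A" "finite B" and ne: "A \<noteq> {}" "B \<noteq> {}"
  shows "card A \<le> Suc (card S)" "2 * (card A + card B) \<le> 3 * card S + 4"
proof -
  have sub: "S \<subseteq> A \<times> B"
    and rows: "\<forall>a\<in>A - fst ` S. \<forall>b\<in>A - fst ` S. a = b"
    and cols: "\<forall>v\<in>B - snd ` S. \<forall>w\<in>B - snd ` S. v = w"
    and lone: "\<And>a b v w. \<lbrakk>a \<in> A; b \<in> A; v \<in> B; w \<in> B; lonely S a v; lonely S b w\<rbrakk> \<Longrightarrow> a = b \<or> v = w"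
    using R unfolding grid_resolving_iff[OF ne] by simp_all
  let ?J = "{x\<in>S. lonely S (fst x) (snd x)}"
  have finS: "finite S" using finite_subset[OF sub] fin by simp
  have proj: "fst ` S \<subseteq> A" "snd ` S \<subseteq> B" using sub by auto
  note A = card_le_Suc_0_Diff[OF fin(1) proj(1) rows]
  note B = card_le_Suc_0_Diff[OF fin(2) proj(2) cols]
  show "card A \<le> Suc (card S)" using A(1) card_image_le[OF finS, of fst] by linarith
  have "x = y" if xy: "x \<in> ?J" "y \<in> ?J" for x y
  proof -
    have "fst x \<in> A" "fst y \<in> A" "snd x \<in> B" "snd y \<in> B" using xy proj by auto
    then have "fst x = fst y \<or> snd x = snd y" using lone xy by simp
    with xy show "x = y" by (auto simp: lonely_def prod_eq_iff)
  qed
  then have J: "card ?J \<le> 1" using finS by (simp add: card_le_Suc0_iff_eq)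
  have J0: "card ?J = 0" if "card A = Suc (card (fst ` S))" "card B = Suc (card (snd ` S))"
  proof -
    from A(2)[OF that(1)] B(2)[OF that(2)] obtain a v
      where av: "a \<in> A" "a \<notin> fst ` S" "v \<in> B" "v \<notin> snd ` S" by blast
    \<comment> \<open>No element of \<open>S\<close> meets row \<open>a\<close> or column
      \<open>v\<close>, so both sides of the equivalence in \<open>lonely\<close> are false; this
      pair then conflicts with any isolated edge.\<close>
    then have a: "lonely S a v" by (auto simp: lonely_def)
    have "\<not> lonely S (fst x) (snd x)" if x: "x \<in> S" for x
    proof
      assume "lonely S (fst x) (snd x)"
      moreover have "fst x \<in> A" "snd x \<in> B" using x proj by auto
      ultimately have "a = fst x \<or> v = snd x" using lone a av by simp
      with av x show False by auto
    qed
    then have J: "?J = {}" by blast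
    show ?thesis unfolding J by simp
  qed
  show "2 * (card A + card B) \<le> 3 * card S + 4"
  proof (cases "card A = Suc (card (fst ` S)) \<and> card B = Suc (card (snd ` S))")
    case True
    then have "card A = Suc (card (fst ` S))" "card B = Suc (card (snd ` S))" "card ?J = 0"
      using J0 by blast+
    with card_projections_le[OF finS] show ?thesis by simp
  next
    case False
    with A(1) B(1) have "card A + card B \<le> Suc (card (fst ` S) + card (snd ` S))" by linarith
    with J card_projections_le[OF finS] show ?thesis by simp
  qed
qed

section \<open>Constructions from stars and paths\<close>

text \<open>
  Rows \<open>< s\<close> carry two private columns each; the next \<open>u\<close> rows are distributed cyclically over
  \<open>t\<close> further columns, each of which receives at least two rows when \<open>2 * t \<le> u\<close>.
\<close>
definition fan :: "nat \<Rightarrow> nat \<Rightarrow> nat \<Rightarrow> (nat \<times> nat) set" where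
  "fan s t u = (\<lambda>c. (c div 2, c)) ` {..<2 * s} \<union> (\<lambda>k. (s + k, 2 * s + k mod t)) ` {..<u}"

lemma card_fan: "card (fan s t u) = 2 * s + u"
proof -
  have "card ((\<lambda>c. (c div 2, c)) ` {..<2 * s}) = 2 * s"
    "card ((\<lambda>k. (s + k, 2 * s + k mod t)) ` {..<u}) = u"
    by (simp_all add: card_image inj_on_def)
  moreover have "(\<lambda>c. (c div 2, c)) ` {..<2 * s} \<inter> (\<lambda>k. (s + k, 2 * s + k mod t)) ` {..<u} = {}"
    by auto
  ultimately show ?thesis unfolding fan_def by (simp add: card_Un_disjoint)
qed

lemma fst_fan: "fst ` fan s t u = {..<s + u}"
proof (intro equalityI subsetI)
  fix a assume a: "a \<in> {..<s + u}"
  show "a \<in> fst ` fan s t u"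
  proof (cases "a < s")
    case True
    then have "(a, 2 * a) \<in> fan s t u" unfolding fan_def by force
    then show ?thesis by force
  next
    case False
    then have "(a, 2 * s + (a - s) mod t) \<in> fan s t u"
      using a unfolding fan_def by (intro UnI2 image_eqI[of _ _ "a - s"]) auto
    then show ?thesis by force
  qed
qed (auto simp: fan_def)

text \<open>\<open>t \<le> u\<close> lets every residue occur. The case \<open>t = 0\<close>
  requires \<open>u = 0\<close> because \<open>k mod 0 = k\<close> would spread the rows over
  columns beyond the intended range.\<close>

lemma snd_fan:
  assumes "2 * t \<le> u" "0 < t \<or> u = 0"
  shows "snd ` fan s t u = {..<2 * s + t}"
proof (intro equalityI subsetI)
  fix v assume v: "v \<in> {..<2 * s + t}"
  show "v \<in> snd ` fan s t u"
  proof (cases "v < 2 * s")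
    case True
    then have "(v div 2, v) \<in> fan s t u" unfolding fan_def by force
    then show ?thesis by force
  next
    case False
    then have "(s + (v - 2 * s), v) \<in> fan s t u"
      using v assms unfolding fan_def by (intro UnI2 image_eqI[of _ _ "v - 2 * s"]) auto
    then show ?thesis by force
  qed
next
  fix v assume "v \<in> snd ` fan s t u"
  moreover have "k mod t < t" if "k < u" for k using that assms by (cases t) auto
  ultimately show "v \<in> {..<2 * s + t}" by (auto simp: fan_def)
qed

lemma not_lonely_fan:
  assumes "2 * t \<le> u" "0 < t \<or> u = 0" "a < s + u"
  shows "\<not> lonely (fan s t u) a v"
proof
  assume L: "lonely (fan s t u) a v"
  show False
  proof (cases "a < s")
    case True
    then have "(a, 2 * a) \<in> fan s t u" "(a, 2 * a + 1) \<in> fan s t u"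
      by (auto simp: fan_def image_iff)
    with L have "2 * a = v" "2 * a + 1 = v" unfolding lonely_def by (metis fst_conv snd_conv)+
    then show False by simp
  next
    case False
    define k where "k = a - s"
    with False assms have a: "a = s + k" and k: "k < u" by auto
    then have t: "t > 0" using assms by auto
    \<comment> \<open>Another row at distance \<open>t\<close>, hence in the same column;
      \<open>2 * t \<le> u\<close> keeps \<open>k + t\<close> in range when
      \<open>k < t\<close>.\<close>
    define l where "l = (if k < t then k + t else k - t)"
    have "l < u" "l \<noteq> k" "l mod t = k mod t"
      using k t assms by (auto simp: l_def le_mod_geq)
    have "(s + k, 2 * s + k mod t) \<in> fan s t u" using k by (auto simp: fan_def)
    with L a have "v = 2 * s + k mod t" unfolding lonely_def by fastforce
    moreover have "(s + l, 2 * s + l mod t) \<in> fan s t u" using \<open>l < u\<close> by (auto simp: fan_def)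
    ultimately have "s + l = a" using L \<open>l mod t = k mod t\<close> unfolding lonely_def by fastforce
    with a \<open>l \<noteq> k\<close> show False by simp
  qed
qed

text \<open>Lonely pairs must avoid all rows and columns of the fan. By \<open>nm\<close> only one
  row or only one column lies beyond it, so two lonely pairs always share a coordinate. A superset
  is allowed in order to add one isolated edge.\<close>

lemma grid_resolving_superset_fan:
  assumes t: "2 * t \<le> u" "0 < t \<or> u = 0" and ne: "0 < n" "0 < m"
    and S: "fan s t u \<subseteq> S" "S \<subseteq> {..<n} \<times> {..<m}"
    and rows: "{..<n - 1} \<subseteq> fst ` S" and cols: "{..<m - 1} \<subseteq> snd ` S"
    and nm: "n \<le> s + u + 1 \<or> m \<le> 2 * s + t + 1"
  shows "grid_resolving {..<n} {..<m} S"
proof -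
  have large: "s + u \<le> a \<and> 2 * s + t \<le> v" if L: "lonely S a v" for a v
  proof -
    \<comment> \<open>Being lonely passes to subsets.\<close>
    have L': "lonely (fan s t u) a v" using L S(1) by (auto simp: lonely_def)
    then have a: "s + u \<le> a" using not_lonely_fan[OF t] by (meson not_le)
    have "2 * s + t \<le> v"
    proof (rule ccontr)
      assume "\<not> 2 * s + t \<le> v"
      then have "v \<in> snd ` fan s t u" by (simp add: snd_fan[OF t])
      then obtain b where b: "(b, v) \<in> fan s t u" by auto
      then have "b \<in> fst ` fan s t u" by force
      then have "b < s + u" by (simp add: fst_fan)
      moreover have "b = a" using L' b unfolding lonely_def by force
      ultimately show False using a by simp
    qed
    with a show ?thesis by simp
  qed
  have ne': "{..<n} \<noteq> {}" "{..<m} \<noteq> {}" using ne by (auto simp: lessThan_empty_iff)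
  have "a = n - 1" if "a \<in> {..<n} - fst ` S" for a
    using that rows by (cases "a < n - 1") auto
  then have "\<forall>a\<in>{..<n} - fst ` S. \<forall>b\<in>{..<n} - fst ` S. a = b" by metis
  moreover have "v = m - 1" if "v \<in> {..<m} - snd ` S" for v
    using that cols by (cases "v < m - 1") auto
  then have "\<forall>v\<in>{..<m} - snd ` S. \<forall>w\<in>{..<m} - snd ` S. v = w" by metis
  moreover have "a = b \<or> v = w"
    if "a < n" "b < n" "v < m" "w < m" "lonely S a v" "lonely S b w" for a b v w
    using large[OF that(5)] large[OF that(6)] that nm by linarith
  then have "\<forall>a\<in>{..<n}. \<forall>b\<in>{..<n}. \<forall>v\<in>{..<m}. \<forall>w\<in>{..<m}.
      lonely S a v \<longrightarrow> lonely S b w \<longrightarrow> a = b \<or> v = w" by simp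
  ultimately show ?thesis
    using S(2) by (intro grid_resolving_iff[OF ne', THEN iffD2] conjI)
qed

lemma grid_resolving_fan:
  assumes "2 * t \<le> u" "0 < t \<or> u = 0" "0 < n" "0 < m"
    and "s + u \<le> n" "n \<le> s + u + 1" "2 * s + t \<le> m" "m \<le> 2 * s + t + 1"
  shows "grid_resolving {..<n} {..<m} (fan s t u)"
proof (rule grid_resolving_superset_fan[OF assms(1-4) order_refl])
  have "fan s t u \<subseteq> fst ` fan s t u \<times> snd ` fan s t u" by force
  also have "\<dots> \<subseteq> {..<n} \<times> {..<m}" using assms by (auto simp: fst_fan snd_fan)
  finally show "fan s t u \<subseteq> {..<n} \<times> {..<m}" .
qed (use assms in \<open>auto simp: fst_fan snd_fan\<close>)

text \<open>The added element is the one permitted isolated edge: it fills the last column, so that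
  only row \<open>n - 1\<close> stays isolated and no column does.\<close>

lemma grid_resolving_insert_fan:
  assumes "2 * t \<le> u" "0 < t \<or> u = 0" "0 < m"
    and "n = s + u + 2" "m = 2 * s + t + 1"
  shows "grid_resolving {..<n} {..<m} (insert (s + u, 2 * s + t) (fan s t u))"
    "card (insert (s + u, 2 * s + t) (fan s t u)) = 2 * s + u + 1"
proof -
  have sub: "fan s t u \<subseteq> {..<s + u} \<times> {..<2 * s + t}"
    using fst_fan[of s t u] snd_fan[OF assms(1,2), of s] by force
  then have "(s + u, 2 * s + t) \<notin> fan s t u" by auto
  moreover have "finite (fan s t u)" by (simp add: fan_def)
  ultimately show "card (insert (s + u, 2 * s + t) (fan s t u)) = 2 * s + u + 1"
    by (simp add: card_fan)
  show "grid_resolving {..<n} {..<m} (insert (s + u, 2 * s + t) (fan s t u))"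
    using assms sub
    by (intro grid_resolving_superset_fan[of t u n m s]) (auto simp: fst_fan snd_fan)
qed

text \<open>Splits \<open>a\<close> rows and \<open>b\<close> columns into \<open>s\<close> paths
  with one row and two columns and \<open>t\<close> paths with two rows and one column. The solution
  is \<open>s = b - q\<close>, \<open>t = a - q\<close>; the two inequalities say that neither is
  negative.\<close>

lemma two_one_packing:
  fixes a b q :: nat
  assumes "a + b = 3 * q" "a \<le> 2 * b" "b \<le> 2 * a"
  obtains s t where "s + 2 * t = a" "2 * s + t = b"
proof
  show "(b - q) + 2 * (a - q) = a" "2 * (b - q) + (a - q) = b" using assms by linarith+
qed

text \<open>With \<open>u = 2 * t\<close> the fan consists of paths on three vertices. To make the
  rest divisible by 3, residue 2 of \<open>n + m\<close> leaves out a row and a column, residue 1 a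
  row, and residue 0 a row together with the two ends of an isolated edge.\<close>

lemma ex_grid_resolving_le:
  assumes nm: "m \<le> n" "1 \<le> m" "n \<le> 2 * m - 1"
  obtains S where "grid_resolving {..<n} {..<m} S" "3 * card S + 2 \<le> 2 * (n + m)"
proof -
  define q where "q = (n + m) div 3"
  consider (0) "n + m = 3 * q" | (1) "n + m = 3 * q + 1" | (2) "n + m = 3 * q + 2"
    unfolding q_def by linarith
  then show thesis
  proof cases
    case 0
    \<comment> \<open>For \<open>n \<le> 2\<close> the bounds force \<open>m = n\<close>, and
      neither 2 nor 4 is divisible by 3.\<close>
    have "n \<noteq> 1" "n \<noteq> 2" using 0 nm by presburger+
    then have "3 \<le> n" using nm by linarith
    obtain s t where "s + 2 * t = n - 2" "2 * s + t = m - 1"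
      by (rule two_one_packing[of "n - 2" "m - 1" "q - 1"]) (use 0 nm \<open>3 \<le> n\<close> in linarith)+
    then have st: "n = s + 2 * t + 2" "m = 2 * s + t + 1" using nm \<open>3 \<le> n\<close> by linarith+
    show thesis
    proof (rule that)
      show "grid_resolving {..<n} {..<m} (insert (s + 2 * t, 2 * s + t) (fan s t (2 * t)))"
        by (rule grid_resolving_insert_fan) (use st in auto)
      have "card (insert (s + 2 * t, 2 * s + t) (fan s t (2 * t))) = 2 * s + 2 * t + 1"
        by (rule grid_resolving_insert_fan[OF _ _ _ st]) (use st in auto)
      then show "3 * card (insert (s + 2 * t, 2 * s + t) (fan s t (2 * t))) + 2 \<le> 2 * (n + m)"
        unfolding st by simp
    qed
  next
    case 1
    have "n \<noteq> 1" using 1 nm by presburger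
    then have "2 \<le> n" using nm by linarith
    obtain s t where "s + 2 * t = n - 1" "2 * s + t = m"
      by (rule two_one_packing[of "n - 1" m q]) (use 1 nm \<open>2 \<le> n\<close> in linarith)+
    then have st: "n = s + 2 * t + 1" "m = 2 * s + t" using nm by linarith+
    show thesis
    proof (rule that)
      show "grid_resolving {..<n} {..<m} (fan s t (2 * t))"
        by (rule grid_resolving_fan) (use st nm in linarith)+
      show "3 * card (fan s t (2 * t)) + 2 \<le> 2 * (n + m)" using st by (simp add: card_fan)
    qed
  next
    case 2
    obtain s t where "s + 2 * t = n - 1" "2 * s + t = m - 1"
      by (rule two_one_packing[of "n - 1" "m - 1" q]) (use 2 nm in linarith)+
    then have st: "n = s + 2 * t + 1" "m = 2 * s + t + 1" using nm by linarith+
    show thesis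
    proof (rule that)
      show "grid_resolving {..<n} {..<m} (fan s t (2 * t))"
        by (rule grid_resolving_fan) (use st nm in linarith)+
      show "3 * card (fan s t (2 * t)) + 2 \<le> 2 * (n + m)" using st by (simp add: card_fan)
    qed
  qed
qed

text \<open>Leaving out one row and one column, \<open>2 * (m - 1) \<le> n - 1\<close> gives each
  remaining column a star with at least two rows.\<close>

lemma ex_grid_resolving_ge:
  assumes nm: "1 \<le> m" "2 * m - 1 < n"
  obtains S where "grid_resolving {..<n} {..<m} S" "card S = n - 1"
proof -
  \<comment> \<open>For \<open>m = 1\<close> the only column cannot be left out: it is the centre of
    a star if \<open>n \<ge> 3\<close>, and for \<open>n = 2\<close> a single edge serves.\<close>
  consider "n = 2" "m = 1" | "3 \<le> n" "m = 1" | "2 \<le> m" using nm by linarith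
  then show thesis
  proof cases
    case 1
    then show thesis
      using grid_resolving_insert_fan[of 0 0 m n 0] that[of "insert (0, 0) (fan 0 0 0)"] by simp
  next
    case 2
    have "grid_resolving {..<n} {..<m} (fan 0 1 (n - 1))"
      by (rule grid_resolving_fan) (use 2 in linarith)+
    then show thesis by (rule that) (simp add: card_fan)
  next
    case 3
    have "grid_resolving {..<n} {..<m} (fan 0 (m - 1) (n - 1))"
      by (rule grid_resolving_fan) (use 3 nm in linarith)+
    then show thesis by (rule that) (simp add: card_fan)
  qed
qed

theorem theorem6p1:
  fixes G :: "'a pair_pre_digraph" and H :: "'b pair_pre_digraph" and n m :: nat
  assumes "n \<ge> m" and "m \<ge> 1"
    and "complete_digraph n (with_proj G)" and "complete_digraph m (with_proj H)"
  shows "(m \<le> n \<and> n \<le> 2 * m - 1 \<longrightarrow>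
           int (\<beta> (with_proj (G \<box> H))) = \<lfloor>2 / 3 * (real n + real m - 1)\<rfloor>) \<and>
         (n \<ge> 2 * m - 1 \<longrightarrow> \<beta> (with_proj (G \<box> H)) = n - 1)"
proof -
  let ?A = "pverts G" and ?B = "pverts H" and ?b = "\<beta> (with_proj (G \<box> H))"
  have card: "finite ?A" "card ?A = n" "finite ?B" "card ?B = m"
    using assms(3,4) by (simp_all add: complete_digraph_pair_def)
  have ne: "?A \<noteq> {}" "?B \<noteq> {}" using card assms(1,2) by auto
  let ?P = "\<lambda>k. \<exists>S. grid_resolving ?A ?B S \<and> finite S \<and> card S = k"
  have b: "?b = (LEAST k. ?P k)"
    by (simp add: metric_dim_def resolving_set_complete_product[OF assms(3,4)])
  obtain S where S: "grid_resolving {..<n} {..<m} S"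
    "if n \<le> 2 * m - 1 then 3 * card S + 2 \<le> 2 * (n + m) else card S = n - 1"
    using ex_grid_resolving_le[OF assms(1,2)] ex_grid_resolving_ge[OF assms(2)]
    by (metis not_le)
  obtain f g where "bij_betw f {..<n} ?A" "bij_betw g {..<m} ?B"
    using card by (metis bij_betw_iff_card card_lessThan finite_lessThan)
  note transfer = grid_resolving_transfer[OF S(1) this]
  have "S \<subseteq> {..<n} \<times> {..<m}" using S(1) by (simp add: grid_resolving_def)
  then have "finite S" by (rule finite_subset) simp
  with transfer have P: "?P (card S)" by (intro exI[of _ "map_prod f g ` S"]) simp
  then have upper: "?b \<le> card S" unfolding b by (rule Least_le[where P = ?P])
  from P have "?P ?b" unfolding b by (rule LeastI[where P = ?P])
  then obtain T where "grid_resolving ?A ?B T" "card T = ?b" by blast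
  then have lower: "n \<le> Suc ?b" "2 * (n + m) \<le> 3 * ?b + 4"
    using grid_resolving_card_ge[of ?A ?B T] card ne by auto
  have "int ?b = \<lfloor>2 / 3 * (real n + real m - 1)\<rfloor>" if "n \<le> 2 * m - 1"
  proof -
    have "3 * ?b + 2 \<le> 2 * (n + m)" using S(2) that upper by simp
    then have "real (3 * ?b + 2) \<le> real (2 * (n + m))" by (simp only: of_nat_le_iff)
    moreover have "real (2 * (n + m)) \<le> real (3 * ?b + 4)" using lower(2) by (simp only: of_nat_le_iff)
    \<comment> \<open>The bounds say \<open>3 * ?b \<le> 2 * (n + m - 1) \<le> 3 * ?b + 2\<close>,
      and the right end is below \<open>3 * (?b + 1)\<close>.\<close>
    ultimately show ?thesis by (intro floor_unique[symmetric]) auto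
  qed
  moreover have "?b = n - 1" if "n \<ge> 2 * m - 1"
  proof (cases "n = 2 * m - 1")
    case True
    \<comment> \<open>On the overlap of the two cases \<open>S\<close> comes from the path packing;
      substituting \<open>2 * m = n + 1\<close> turns its bound into
      \<open>3 * ?b + 2 \<le> 3 * n + 1\<close>, which forces \<open>?b < n\<close>.\<close>
    then have "3 * ?b + 2 \<le> 2 * (n + m)" using S(2) upper by simp
    moreover have "n + 1 = 2 * m" using True assms(2) by linarith
    ultimately have "3 * ?b < 3 * n" unfolding distrib_left by linarith
    with lower(1) show ?thesis by linarith
  next
    case False
    with that S(2) have "card S = n - 1" by simp
    with upper lower(1) show ?thesis by linarith
  qed
  ultimately show ?thesis by blast
qed

end
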